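(* Let $p=n^{-1+1/12}$ and let $D$ be the random $n$-vertex directed graph obtained as follows. First, for every ordered pair $(u,v)$ of distinct vertices, independently insert an arc from $u$ to $v$ with probability $p$ (these are called forward arcs). Next, whenever there is a forward arc from $u$ to $v$ and a forward arc from $v$ to $w$, insert an arc from $w$ to $u$ (called backward arcs). Then asymptotically almost surely (as $n\to\infty$), $\nu_t(D)=pn^2/2+o(n^{13/12})$ and $\tau_t(D)=3pn^2/4-o(n^{13/12})$.
   Context: A directed triangle is a triple of arcs $uv,vw,wu$ on three distinct vertices. $\nu_t(D)$ is the maximum number of pairwise arc-disjoint directed triangles in $D$; $\tau_t(D)$ is the minimum number of arcs whose removal leaves no directed triangle. *)

theory Defs
  imports
    "HOL-Probability.Probability"
    "HOL-Probability.Product_PMF"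
    "HOL-Library.Landau_Symbols"
    "Graph_Theory.Pair_Digraph"
begin

text \<open>
  A directed triangle is represented by its set of three arcs, so the three rotations of
  $(u,v,w)$ yield the same triangle.
\<close>

definition directed_triangles :: "'a pair_pre_digraph \<Rightarrow> ('a \<times> 'a) set set" where
  "directed_triangles D =
     {{(u, v), (v, w), (w, u)} | u v w.
        u \<noteq> v \<and> v \<noteq> w \<and> w \<noteq> u \<and> {(u, v), (v, w), (w, u)} \<subseteq> parcs D}"

definition arc_disjoint_triangle_packing ::
    "'a pair_pre_digraph \<Rightarrow> ('a \<times> 'a) set set \<Rightarrow> bool" where
  "arc_disjoint_triangle_packing D T \<longleftrightarrow> T \<subseteq> directed_triangles D \<and> pairwise disjnt T"

definition triangle_arc_cover :: "'a pair_pre_digraph \<Rightarrow> ('a \<times> 'a) set \<Rightarrow> bool" where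
  "triangle_arc_cover D C \<longleftrightarrow>
     C \<subseteq> parcs D \<and> directed_triangles (D\<lparr>parcs := parcs D - C\<rparr>) = {}"

text \<open>
  The following two numbers are meaningful for digraphs with finitely many arcs only, since
  \<^const>\<open>Max\<close>, \<^const>\<open>Min\<close> and \<^const>\<open>card\<close> are unspecified or degenerate on infinite sets.
\<close>

definition nu_t :: "'a pair_pre_digraph \<Rightarrow> nat" where
  "nu_t D = Max (card ` {T. arc_disjoint_triangle_packing D T})"

definition tau_t :: "'a pair_pre_digraph \<Rightarrow> nat" where
  "tau_t D = Min (card ` {C. triangle_arc_cover D C})"

text \<open>
  The case \<open>w = u\<close> is excluded from the backward arcs, since it would yield a loop. The arcs
  form a set: an arc arising in several ways is present once.
\<close>

definition backward_arcs :: "('a \<times> 'a) set \<Rightarrow> ('a \<times> 'a) set" where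
  "backward_arcs F = {(w, u) | u v w. (u, v) \<in> F \<and> (v, w) \<in> F \<and> w \<noteq> u}"

definition forward_arcs_pmf :: "nat \<Rightarrow> real \<Rightarrow> (nat \<times> nat) set pmf" where
  "forward_arcs_pmf n p =
     map_pmf (\<lambda>X. {e. X e})
       (Pi_pmf {(u, v). u < n \<and> v < n \<and> u \<noteq> v} False (\<lambda>_. bernoulli_pmf p))"

definition random_digraph :: "nat \<Rightarrow> real \<Rightarrow> nat pair_pre_digraph pmf" where
  "random_digraph n p =
     map_pmf (\<lambda>F. \<lparr>pverts = {..<n}, parcs = F \<union> backward_arcs F\<rparr>) (forward_arcs_pmf n p)"

lemma finite_directed_triangles:
  assumes "finite (parcs D)"
  shows "finite (directed_triangles D)"
proof (rule finite_subset)
  show "directed_triangles D \<subseteq> Pow (parcs D)"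
    by (auto simp: directed_triangles_def)
qed (use assms in simp)

lemma nu_t_attained:
  assumes "finite (parcs D)"
  obtains T where "arc_disjoint_triangle_packing D T" "card T = nu_t D"
    and "\<And>T'. arc_disjoint_triangle_packing D T' \<Longrightarrow> card T' \<le> nu_t D"
proof -
  let ?P = "{T. arc_disjoint_triangle_packing D T}"
  have "?P \<subseteq> Pow (directed_triangles D)"
    by (auto simp: arc_disjoint_triangle_packing_def)
  then have fin: "finite (card ` ?P)"
    using finite_directed_triangles[OF assms] by (meson finite_Pow_iff finite_imageI finite_subset)
  moreover have "{} \<in> ?P"
    by (simp add: arc_disjoint_triangle_packing_def)
  ultimately have "nu_t D \<in> card ` ?P"
    unfolding nu_t_def by (intro Max_in) auto
  moreover have "card T' \<le> nu_t D" if "arc_disjoint_triangle_packing D T'" for T'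
    unfolding nu_t_def using fin that by (intro Max_ge) auto
  ultimately show thesis
    using that by auto
qed

lemma tau_t_attained:
  assumes "finite (parcs D)"
  obtains C where "triangle_arc_cover D C" "card C = tau_t D"
    and "\<And>C'. triangle_arc_cover D C' \<Longrightarrow> tau_t D \<le> card C'"
proof -
  let ?P = "{C. triangle_arc_cover D C}"
  have "?P \<subseteq> Pow (parcs D)"
    by (auto simp: triangle_arc_cover_def)
  then have fin: "finite (card ` ?P)"
    using assms by (meson finite_Pow_iff finite_imageI finite_subset)
  moreover have "parcs D \<in> ?P"
    by (auto simp: triangle_arc_cover_def directed_triangles_def)
  ultimately have "tau_t D \<in> card ` ?P"
    unfolding tau_t_def by (intro Min_in) auto
  moreover have "tau_t D \<le> card C'" if "triangle_arc_cover D C'" for C'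
    unfolding tau_t_def using fin that by (intro Min_le) auto
  ultimately show thesis
    using that by auto
qed

lemma random_digraph_loopfree:
  assumes "D \<in> set_pmf (random_digraph n p)"
  shows "pair_fin_digraph D" "pair_loopfree_digraph D"
proof -
  obtain F where D: "D = \<lparr>pverts = {..<n}, parcs = F \<union> backward_arcs F\<rparr>"
    and "F \<in> set_pmf (forward_arcs_pmf n p)"
    using assms by (auto simp: random_digraph_def)
  then have F: "F \<subseteq> {(u, v). u < n \<and> v < n \<and> u \<noteq> v}"
  proof -
    have fin: "finite {(u, v). u < n \<and> v < (n :: nat) \<and> u \<noteq> v}"
      by (rule finite_subset[of _ "{..<n} \<times> {..<n}"]) auto
    show ?thesis
      using \<open>F \<in> _\<close> unfolding forward_arcs_pmf_def
      by (auto dest!: subsetD[OF set_Pi_pmf_subset[OF fin]])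
  qed
  then have A: "parcs D \<subseteq> {(u, v). u < n \<and> v < n \<and> u \<noteq> v}"
    unfolding D backward_arcs_def by auto
  have "finite (parcs D)"
    by (rule finite_subset[of _ "{..<n} \<times> {..<n}"]) (use A in auto)
  then show "pair_fin_digraph D"
    using A by unfold_locales (auto simp: D)
  show "pair_loopfree_digraph D"
    using A by unfold_locales (auto simp: D)
qed

end

theory Submission
  imports Defs "HOL-Real_Asymp.Real_Asymp"
begin

text \<open>
  Write \<open>d = n p = n powr (1/12)\<close>. A triangle with at most one forward arc, a forward path whose
  closing arc is forward too, and a backward arc closing two forward paths all come from a copy in
  the forward arcs of a configuration with \<open>k \<le> 6\<close> arcs on at most \<open>k\<close> vertices. The expected
  number of these is \<open>O(d ^ 6) = O(sqrt n)\<close>, which is negligible. Up to this error, triangles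
  correspond to forward paths with two arcs, and each backward arc lies in one triangle only.

  Every triangle of a packing uses two of the about \<open>p n\<^sup>2\<close> forward arcs, which bounds \<open>\<nu>\<^sub>t\<close> from
  above. For the lower bound assign each forward arc to its larger endpoint: a vertex \<open>v\<close> receives
  in-arcs and out-arcs from the same number \<open>v\<close> of candidates, so nearly all of them can be paired
  into paths through \<open>v\<close>.

  A cover may be assumed to consist of forward arcs. The forward arcs that it misses contain no path
  with two arcs, so they lie in a directed cut. A Chernoff and union bound shows that all directed
  cuts have at most \<open>p n\<^sup>2 / 4 + O(n sqrt d)\<close> forward arcs, and the cut into halves attains this.
\<close>

section \<open>Bounds for a fixed set of forward arcs\<close>

definition arc_pairs :: "nat \<Rightarrow> (nat \<times> nat) set" where
  "arc_pairs n = {(u, v). u < n \<and> v < n \<and> u \<noteq> v}"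

lemma arc_pairs_iff [simp]: "(u, v) \<in> arc_pairs n \<longleftrightarrow> u < n \<and> v < n \<and> u \<noteq> v"
  by (simp add: arc_pairs_def)

lemma arc_pairs_subset: "arc_pairs n \<subseteq> {..<n} \<times> {..<n}"
  by (auto simp: arc_pairs_def)

lemma finite_arc_pairs [simp]: "finite (arc_pairs n)"
  by (rule finite_subset[OF arc_pairs_subset]) auto

lemma finite_arcs: "F \<subseteq> arc_pairs n \<Longrightarrow> finite F"
  by (rule finite_subset) auto

lemma arcs_lt: "F \<subseteq> arc_pairs n \<Longrightarrow> (u, v) \<in> F \<Longrightarrow> u < n \<and> v < n \<and> u \<noteq> v"
  by (metis arc_pairs_iff subsetD)

definition closure_digraph :: "nat \<Rightarrow> (nat \<times> nat) set \<Rightarrow> nat pair_pre_digraph" where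
  "closure_digraph n F = \<lparr>pverts = {..<n}, parcs = F \<union> backward_arcs F\<rparr>"

section \<open>Configurations of forward arcs and their copies\<close>

definition two_cycles :: "nat \<Rightarrow> (nat \<times> nat) set" where
  "two_cycles n = arc_pairs n"

definition two_cycle_arcs :: "nat \<times> nat \<Rightarrow> (nat \<times> nat) set" where
  "two_cycle_arcs = (\<lambda>(u, v). {(u, v), (v, u)})"

definition three_cycles :: "nat \<Rightarrow> (nat \<times> nat \<times> nat) set" where
  "three_cycles n = {(u, v, w). u < n \<and> v < n \<and> w < n \<and> u \<noteq> v \<and> v \<noteq> w \<and> u \<noteq> w}"

definition three_cycle_arcs :: "nat \<times> nat \<times> nat \<Rightarrow> (nat \<times> nat) set" where
  "three_cycle_arcs = (\<lambda>(u, v, w). {(u, v), (v, w), (w, u)})"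

text \<open>Two forward paths from \<open>u\<close> to \<open>w\<close>, through \<open>v\<close>
  and through \<open>x\<close>, so that the arc from \<open>w\<close> to \<open>u\<close> closes
  both.\<close>

definition double_paths :: "nat \<Rightarrow> (nat \<times> nat \<times> nat \<times> nat) set" where
  "double_paths n = {(u, v, x, w). u < n \<and> v < n \<and> x < n \<and> w < n \<and>
     v \<noteq> x \<and> u \<noteq> w \<and> u \<noteq> v \<and> u \<noteq> x \<and> v \<noteq> w \<and> x \<noteq> w}"

definition double_path_arcs :: "nat \<times> nat \<times> nat \<times> nat \<Rightarrow> (nat \<times> nat) set" where
  "double_path_arcs = (\<lambda>(u, v, x, w). {(u, v), (v, w), (u, x), (x, w)})"

text \<open>
  A triangle with at most one forward arc unfolds into one of the following two configurations.
  The outer vertices \<open>x\<close>, \<open>y\<close>, \<open>z\<close> may coincide, but the listed arcs are always distinct.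
\<close>

definition pentagons :: "nat \<Rightarrow> (nat \<times> nat \<times> nat \<times> nat \<times> nat) set" where
  "pentagons n = {(u, v, w, x, y). u < n \<and> v < n \<and> w < n \<and> x < n \<and> y < n \<and>
     u \<noteq> v \<and> v \<noteq> w \<and> u \<noteq> w \<and> x \<notin> {u, v, w} \<and> y \<notin> {u, v, w}}"

definition pentagon_arcs :: "nat \<times> nat \<times> nat \<times> nat \<times> nat \<Rightarrow> (nat \<times> nat) set" where
  "pentagon_arcs = (\<lambda>(u, v, w, x, y). {(u, v), (w, x), (x, v), (u, y), (y, w)})"

definition hexagons :: "nat \<Rightarrow> (nat \<times> nat \<times> nat \<times> nat \<times> nat \<times> nat) set" where
  "hexagons n = {(u, v, w, x, y, z). u < n \<and> v < n \<and> w < n \<and> x < n \<and> y < n \<and> z < n \<and>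
     u \<noteq> v \<and> v \<noteq> w \<and> u \<noteq> w \<and> x \<notin> {u, v, w} \<and> y \<notin> {u, v, w} \<and> z \<notin> {u, v, w}}"

definition hexagon_arcs :: "nat \<times> nat \<times> nat \<times> nat \<times> nat \<times> nat \<Rightarrow> (nat \<times> nat) set" where
  "hexagon_arcs = (\<lambda>(u, v, w, x, y, z). {(w, x), (x, v), (u, y), (y, w), (v, z), (z, u)})"

text \<open>Index tuples are counted, not arc sets. Symmetric tuples count repeatedly, which only
  enlarges the error bounds, and expectations follow by linearity over \<open>I\<close>.\<close>

definition copies :: "'i set \<Rightarrow> ('i \<Rightarrow> 'e set) \<Rightarrow> 'e set \<Rightarrow> 'i set" where
  "copies I A F = {i \<in> I. A i \<subseteq> F}"

lemma finite_config [simp]: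
  "finite (two_cycles n)" "finite (three_cycles n)" "finite (double_paths n)"
  "finite (pentagons n)" "finite (hexagons n)"
proof -
  show "finite (two_cycles n)"
    by (simp add: two_cycles_def)
  show "finite (three_cycles n)"
    by (rule finite_subset[of _ "{..<n} \<times> {..<n} \<times> {..<n}"]) (auto simp: three_cycles_def)
  show "finite (double_paths n)"
    by (rule finite_subset[of _ "{..<n} \<times> {..<n} \<times> {..<n} \<times> {..<n}"])
       (auto simp: double_paths_def)
  show "finite (pentagons n)"
    by (rule finite_subset[of _ "{..<n} \<times> {..<n} \<times> {..<n} \<times> {..<n} \<times> {..<n}"])
       (auto simp: pentagons_def)
  show "finite (hexagons n)"
    by (rule finite_subset[of _ "{..<n} \<times> {..<n} \<times> {..<n} \<times> {..<n} \<times> {..<n} \<times> {..<n}"])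
       (auto simp: hexagons_def)
qed

lemma finite_copies [simp]: "finite I \<Longrightarrow> finite (copies I A F)"
  by (simp add: copies_def)

lemma card_config_le:
  "card (two_cycles n) \<le> n ^ 2" "card (three_cycles n) \<le> n ^ 3" "card (double_paths n) \<le> n ^ 4"
  "card (pentagons n) \<le> n ^ 5" "card (hexagons n) \<le> n ^ 6"
proof -
  have "card (two_cycles n) \<le> card ({..<n} \<times> {..<n})"
    by (rule card_mono) (auto simp: two_cycles_def)
  then show "card (two_cycles n) \<le> n ^ 2"
    by (simp add: card_cartesian_product power2_eq_square)
  have "card (three_cycles n) \<le> card ({..<n} \<times> {..<n} \<times> {..<n})"
    by (rule card_mono) (auto simp: three_cycles_def)
  then show "card (three_cycles n) \<le> n ^ 3"
    by (simp add: card_cartesian_product eval_nat_numeral)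
  have "card (double_paths n) \<le> card ({..<n} \<times> {..<n} \<times> {..<n} \<times> {..<n})"
    by (rule card_mono) (auto simp: double_paths_def)
  then show "card (double_paths n) \<le> n ^ 4"
    by (simp add: card_cartesian_product eval_nat_numeral)
  have "card (pentagons n) \<le> card ({..<n} \<times> {..<n} \<times> {..<n} \<times> {..<n} \<times> {..<n})"
    by (rule card_mono) (auto simp: pentagons_def)
  then show "card (pentagons n) \<le> n ^ 5"
    by (simp add: card_cartesian_product eval_nat_numeral)
  have "card (hexagons n) \<le> card ({..<n} \<times> {..<n} \<times> {..<n} \<times> {..<n} \<times> {..<n} \<times> {..<n})"
    by (rule card_mono) (auto simp: hexagons_def)
  then show "card (hexagons n) \<le> n ^ 6"
    by (simp add: card_cartesian_product eval_nat_numeral)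
qed

text \<open>A tuple with \<open>k\<close> entries yields \<open>k\<close> distinct non-loops, even
  if outer vertices coincide. Together with \<open>card_config_le\<close> this bounds each expected
  count by \<open>(n p)^k\<close>.\<close>

lemma config_arcs:
  "i2 \<in> two_cycles n \<Longrightarrow> two_cycle_arcs i2 \<subseteq> arc_pairs n \<and> card (two_cycle_arcs i2) = 2"
  "i3 \<in> three_cycles n \<Longrightarrow> three_cycle_arcs i3 \<subseteq> arc_pairs n \<and> card (three_cycle_arcs i3) = 3"
  "i4 \<in> double_paths n \<Longrightarrow> double_path_arcs i4 \<subseteq> arc_pairs n \<and> card (double_path_arcs i4) = 4"
  "i5 \<in> pentagons n \<Longrightarrow> pentagon_arcs i5 \<subseteq> arc_pairs n \<and> card (pentagon_arcs i5) = 5"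
  "i6 \<in> hexagons n \<Longrightarrow> hexagon_arcs i6 \<subseteq> arc_pairs n \<and> card (hexagon_arcs i6) = 6"
  unfolding two_cycles_def two_cycle_arcs_def three_cycles_def three_cycle_arcs_def
    double_paths_def double_path_arcs_def pentagons_def pentagon_arcs_def
    hexagons_def hexagon_arcs_def
  by (auto simp: card_insert_if arc_pairs_def)

section \<open>Triangles and forward paths\<close>

text \<open>The triangles with at most one forward arc: suitably rotated, only the first arc can be
  forward.\<close>

definition bad_triangles :: "(nat \<times> nat) set \<Rightarrow> (nat \<times> nat) set set" where
  "bad_triangles F = {{(u, v), (v, w), (w, u)} | u v w. u \<noteq> v \<and> v \<noteq> w \<and> w \<noteq> u \<and>
     {(u, v), (v, w), (w, u)} \<subseteq> F \<union> backward_arcs F \<and> (v, w) \<notin> F \<and> (w, u) \<notin> F}"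

definition forward_path :: "(nat \<times> nat) set \<Rightarrow> nat \<Rightarrow> nat \<Rightarrow> nat \<Rightarrow> bool" where
  "forward_path F u v w \<longleftrightarrow> u \<noteq> v \<and> v \<noteq> w \<and> w \<noteq> u \<and> (u, v) \<in> F \<and> (v, w) \<in> F"

lemma directed_triangles_remove:
  "directed_triangles (D\<lparr>parcs := parcs D - C\<rparr>) = {t \<in> directed_triangles D. t \<inter> C = {}}"
  unfolding directed_triangles_def by (auto 4 4)

lemma directed_triangle_of_forward_path:
  assumes "forward_path F u v w"
  shows "{(u, v), (v, w), (w, u)} \<in> directed_triangles (closure_digraph n F)"
proof -
  have "(w, u) \<in> backward_arcs F"
    using assms unfolding backward_arcs_def forward_path_def by blast
  then show ?thesis
    using assms unfolding directed_triangles_def closure_digraph_def forward_path_def by auto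
qed

text \<open>No rotation of \<open>t\<close> is bad, so of any two arcs of \<open>t\<close> at least
  one is forward. Hence two arcs are forward, and some rotation puts them first.\<close>

lemma directed_triangle_cases:
  assumes "t \<in> directed_triangles (closure_digraph n F)" "t \<notin> bad_triangles F"
  obtains u v w where "t = {(u, v), (v, w), (w, u)}" "forward_path F u v w"
proof -
  obtain u v w where t: "t = {(u, v), (v, w), (w, u)}" and ne: "u \<noteq> v" "v \<noteq> w" "w \<noteq> u"
    and sub: "{(u, v), (v, w), (w, u)} \<subseteq> F \<union> backward_arcs F"
    using assms(1) unfolding directed_triangles_def closure_digraph_def by auto
  have r: "t = {(v, w), (w, u), (u, v)}" "t = {(w, u), (u, v), (v, w)}"
    using t by auto
  have sub': "{(v, w), (w, u), (u, v)} \<subseteq> F \<union> backward_arcs F"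
    "{(w, u), (u, v), (v, w)} \<subseteq> F \<union> backward_arcs F"
    using sub by auto
  have "(v, w) \<in> F \<or> (w, u) \<in> F" "(w, u) \<in> F \<or> (u, v) \<in> F" "(u, v) \<in> F \<or> (v, w) \<in> F"
    using assms(2) t r ne sub sub' unfolding bad_triangles_def by blast+
  then show thesis
    using that[OF t] that[OF r(1)] that[OF r(2)] ne unfolding forward_path_def by blast
qed

text \<open>Each backward arc unfolds into a forward path that it closes. This gives a pentagon if
  the remaining arc is forward, and a hexagon otherwise.\<close>

lemma bad_triangles_subset:
  assumes F: "F \<subseteq> arc_pairs n"
  shows "bad_triangles F \<subseteq>
    (\<lambda>(u, v, w, x, y). {(u, v), (v, w), (w, u)}) ` copies (pentagons n) pentagon_arcs F \<union>
    (\<lambda>(u, v, w, x, y, z). {(u, v), (v, w), (w, u)}) ` copies (hexagons n) hexagon_arcs F"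
proof
  fix t assume "t \<in> bad_triangles F"
  then obtain u v w where t: "t = {(u, v), (v, w), (w, u)}" and ne: "u \<noteq> v" "v \<noteq> w" "w \<noteq> u"
    and sub: "{(u, v), (v, w), (w, u)} \<subseteq> F \<union> backward_arcs F"
    and nF: "(v, w) \<notin> F" "(w, u) \<notin> F"
    unfolding bad_triangles_def by auto
  have lt: "a < n \<and> b < n \<and> a \<noteq> b" if "(a, b) \<in> F" for a b
    using arcs_lt[OF F that] .
  obtain x where x: "(w, x) \<in> F" "(x, v) \<in> F"
    using sub nF unfolding backward_arcs_def by auto
  obtain y where y: "(u, y) \<in> F" "(y, w) \<in> F"
    using sub nF unfolding backward_arcs_def by auto
  \<comment> \<open>Forward arcs are not loops, and \<open>x = u\<close> or \<open>y = v\<close>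
    would make \<open>(w, u)\<close> or \<open>(v, w)\<close> forward.\<close>
  have xy: "x \<notin> {u, v, w}" "y \<notin> {u, v, w}"
    using x y lt nF by auto
  show "t \<in> (\<lambda>(u, v, w, x, y). {(u, v), (v, w), (w, u)}) ` copies (pentagons n) pentagon_arcs F \<union>
    (\<lambda>(u, v, w, x, y, z). {(u, v), (v, w), (w, u)}) ` copies (hexagons n) hexagon_arcs F"
  proof (cases "(u, v) \<in> F")
    case True
    have "(u, v, w, x, y) \<in> copies (pentagons n) pentagon_arcs F"
      using True x y xy ne lt unfolding copies_def pentagons_def pentagon_arcs_def by auto
    then show ?thesis
      using t by (intro UnI1 image_eqI[where x = "(u, v, w, x, y)"]) auto
  next
    case False
    then obtain z where z: "(v, z) \<in> F" "(z, u) \<in> F"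
      using sub unfolding backward_arcs_def by auto
    have "z \<notin> {u, v, w}"
      using z lt nF by auto
    then have "(u, v, w, x, y, z) \<in> copies (hexagons n) hexagon_arcs F"
      using z x y xy ne lt unfolding copies_def hexagons_def hexagon_arcs_def by auto
    then show ?thesis
      using t by (intro UnI2 image_eqI[where x = "(u, v, w, x, y, z)"]) auto
  qed
qed

lemma
  assumes F: "F \<subseteq> arc_pairs n"
  shows finite_bad_triangles: "finite (bad_triangles F)"
    and card_bad_triangles_le: "card (bad_triangles F) \<le>
      card (copies (pentagons n) pentagon_arcs F) + card (copies (hexagons n) hexagon_arcs F)"
proof -
  let ?P = "copies (pentagons n) pentagon_arcs F" and ?H = "copies (hexagons n) hexagon_arcs F"
  let ?f = "\<lambda>(u, v, w, x, y). {(u, v), (v, w), (w, u)}"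
  let ?g = "\<lambda>(u, v, w, x, y, z). {(u, v), (v, w), (w, u)}"
  have fin: "finite (?f ` ?P \<union> ?g ` ?H)"
    by simp
  then show "finite (bad_triangles F)"
    using bad_triangles_subset[OF F] by (rule finite_subset[rotated])
  have "card (bad_triangles F) \<le> card (?f ` ?P \<union> ?g ` ?H)"
    by (rule card_mono[OF fin bad_triangles_subset[OF F]])
  also have "\<dots> \<le> card (?f ` ?P) + card (?g ` ?H)"
    by (rule card_Un_le)
  also have "\<dots> \<le> card ?P + card ?H"
    by (intro add_mono card_image_le) auto
  finally show "card (bad_triangles F) \<le> card ?P + card ?H" .
qed

lemma finite_closure_arcs:
  assumes F: "F \<subseteq> arc_pairs n"
  shows "finite (parcs (closure_digraph n F))"
proof (rule finite_subset)
  show "parcs (closure_digraph n F) \<subseteq> arc_pairs n"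
    using F arcs_lt[OF F] unfolding closure_digraph_def backward_arcs_def by auto
qed simp

section \<open>Upper bound for the packing number\<close>

text \<open>The triangles of a packing that are not bad use disjoint pairs of forward arcs; the bad
  ones are merely counted.\<close>

lemma nu_t_upper:
  assumes F: "F \<subseteq> arc_pairs n"
  shows "2 * nu_t (closure_digraph n F) \<le> card F +
    2 * (card (copies (pentagons n) pentagon_arcs F) + card (copies (hexagons n) hexagon_arcs F))"
proof -
  let ?D = "closure_digraph n F"
  obtain T where T: "arc_disjoint_triangle_packing ?D T" and card_T: "card T = nu_t ?D"
    using nu_t_attained[OF finite_closure_arcs[OF F]] by metis
  have T_sub: "T \<subseteq> directed_triangles ?D" and disj: "pairwise disjnt T"
    using T unfolding arc_disjoint_triangle_packing_def by auto
  have finT: "finite T"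
    using finite_subset[OF T_sub] finite_directed_triangles[OF finite_closure_arcs[OF F]] by auto
  have finF: "finite F"
    using F by (rule finite_arcs)
  define G where "G = T - bad_triangles F"
  have two: "2 \<le> card (t \<inter> F)" if t_G: "t \<in> G" for t
  proof -
    obtain u v w where t: "t = {(u, v), (v, w), (w, u)}" and f: "forward_path F u v w"
      using directed_triangle_cases[of t n F] t_G T_sub unfolding G_def by blast
    have "card {(u, v), (v, w)} \<le> card (t \<inter> F)"
      using t f finF by (intro card_mono) (auto simp: forward_path_def)
    then show ?thesis
      using f by (simp add: forward_path_def)
  qed
  have "2 * card G = (\<Sum>t\<in>G. 2)"
    by simp
  also have "\<dots> \<le> (\<Sum>t\<in>G. card (t \<inter> F))"
    by (intro sum_mono two)
  also have "\<dots> = card (\<Union>t\<in>G. t \<inter> F)"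
    using finT finF disj unfolding G_def
    by (intro card_UN_disjoint[symmetric]) (auto simp: pairwise_def disjnt_def)
  also have "\<dots> \<le> card F"
    using finF by (intro card_mono) auto
  finally have G: "2 * card G \<le> card F" .
  have "card T \<le> card (G \<union> bad_triangles F)"
    using finT finite_bad_triangles[OF F] unfolding G_def by (intro card_mono) auto
  also have "\<dots> \<le> card G + card (bad_triangles F)"
    by (rule card_Un_le)
  finally have "2 * card T \<le> card F + 2 * card (bad_triangles F)"
    using G by linarith
  then show ?thesis
    using mult_le_mono2[OF card_bad_triangles_le[OF F], of 2] unfolding card_T
    by (rule order_trans[OF _ add_left_mono])
qed

section \<open>Bounds for the covering number\<close>

text \<open>The cover consists of all forward arcs that do not lead from \<open>S\<close> to its
  complement and one arc of each bad triangle. The middle vertex of a forward path cannot lie both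
  outside and inside \<open>S\<close>, so the cover contains an arc of the path.\<close>

lemma tau_t_upper:
  assumes F: "F \<subseteq> arc_pairs n"
  shows "tau_t (closure_digraph n F) + card (F \<inter> S \<times> (- S)) \<le> card F +
    (card (copies (pentagons n) pentagon_arcs F) + card (copies (hexagons n) hexagon_arcs F))"
proof -
  let ?D = "closure_digraph n F"
  have finF: "finite F"
    using F by (rule finite_arcs)
  define pick where "pick = (\<lambda>t :: (nat \<times> nat) set. SOME e. e \<in> t)"
  have pick: "pick t \<in> t" if "t \<in> bad_triangles F" for t
  proof -
    have "t \<noteq> {}" using that unfolding bad_triangles_def by auto
    then show ?thesis unfolding pick_def by (simp add: some_in_eq)
  qed
  have bad_sub: "t \<subseteq> parcs ?D" if "t \<in> bad_triangles F" for t
    using that unfolding bad_triangles_def closure_digraph_def by auto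
  define C where "C = (F - S \<times> (- S)) \<union> pick ` bad_triangles F"
  have "triangle_arc_cover ?D C"
    unfolding triangle_arc_cover_def
  proof
    show "C \<subseteq> parcs ?D"
      using pick bad_sub unfolding C_def by (fastforce simp: closure_digraph_def)
    show "directed_triangles (?D\<lparr>parcs := parcs ?D - C\<rparr>) = {}"
    proof (rule ccontr)
      assume "directed_triangles (?D\<lparr>parcs := parcs ?D - C\<rparr>) \<noteq> {}"
      then obtain t where t: "t \<in> directed_triangles (?D\<lparr>parcs := parcs ?D - C\<rparr>)"
        by auto
      then have tD: "t \<in> directed_triangles ?D" and tC: "t \<inter> C = {}"
        unfolding directed_triangles_remove by auto
      show False
      proof (cases "t \<in> bad_triangles F")
        case True
        then show False
          using pick tC unfolding C_def by auto
      next
        case False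
        then obtain u v w where "t = {(u, v), (v, w), (w, u)}" "forward_path F u v w"
          using directed_triangle_cases tD by metis
        then show False
          using tC unfolding C_def forward_path_def by auto
      qed
    qed
  qed
  then have "tau_t ?D \<le> card C"
    using tau_t_attained[OF finite_closure_arcs[OF F]] by metis
  also have "\<dots> \<le> card (F - S \<times> (- S)) + card (pick ` bad_triangles F)"
    unfolding C_def by (rule card_Un_le)
  also have "\<dots> \<le> card (F - S \<times> (- S)) + card (bad_triangles F)"
    using card_image_le[OF finite_bad_triangles[OF F]] by simp
  finally have "tau_t ?D \<le> card (F - S \<times> (- S)) + card (bad_triangles F)" .
  moreover have "card (F - S \<times> (- S)) + card (F \<inter> S \<times> (- S)) = card F"
    using finF card_Int_Diff[of F "S \<times> (- S)"] by simp
  ultimately show ?thesis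
    using card_bad_triangles_le[OF F] by linarith
qed

text \<open>A vertex with an outgoing arc in \<open>H\<close> has no incoming one, so every head
  lies outside \<open>Domain H\<close>.\<close>

lemma path_free_subset_dicut:
  assumes "\<And>u v w. (u, v) \<in> H \<Longrightarrow> (v, w) \<notin> H"
  shows "H \<subseteq> (Domain H) \<times> (- Domain H)"
  using assms by auto

text \<open>A minimum cover is turned into a set \<open>R\<close> of forward arcs, larger by at most
  the three counts, whose removal leaves no path with two arcs. The arcs that are left lie in a
  directed cut, so there are at most \<open>m\<close> of them.\<close>

lemma tau_t_lower:
  assumes F: "F \<subseteq> arc_pairs n"
    and cut: "\<And>S. S \<subseteq> {..<n} \<Longrightarrow> real (card (F \<inter> S \<times> ({..<n} - S))) \<le> m"
  shows "real (card F) \<le> real (tau_t (closure_digraph n F)) + m +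
    card (copies (two_cycles n) two_cycle_arcs F) +
    card (copies (three_cycles n) three_cycle_arcs F) +
    card (copies (double_paths n) double_path_arcs F)"
proof -
  let ?D = "closure_digraph n F"
  let ?X2 = "copies (two_cycles n) two_cycle_arcs F"
  let ?X3 = "copies (three_cycles n) three_cycle_arcs F"
  let ?X4 = "copies (double_paths n) double_path_arcs F"
  have finF: "finite F"
    using F by (rule finite_arcs)
  have lt: "a < n \<and> b < n \<and> a \<noteq> b" if "(a, b) \<in> F" for a b
    using arcs_lt[OF F that] .
  obtain C where C: "triangle_arc_cover ?D C" and card_C: "card C = tau_t ?D"
    using tau_t_attained[OF finite_closure_arcs[OF F]] by metis
  have C_sub: "C \<subseteq> F \<union> backward_arcs F"
    using C unfolding triangle_arc_cover_def closure_digraph_def by auto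
  have finC: "finite C"
    using C finite_closure_arcs[OF F] finite_subset unfolding triangle_arc_cover_def by auto
  \<comment> \<open>\<open>R\<close> replaces a backward arc of \<open>C\<close> by the first arc of one forward path that it closes;
    the remaining parts of \<open>R\<close> destroy the few configurations where this is not enough.\<close>
  define mid where "mid = (\<lambda>(w, u). (u, SOME v. (u, v) \<in> F \<and> (v, w) \<in> F))"
  define R where "R = (C \<inter> F) \<union> mid ` (C - F) \<union> ?X2 \<union>
    (\<lambda>(u, v, w). (u, v)) ` ?X3 \<union> (\<lambda>(u, v, x, w). (u, v)) ` ?X4"
  have finR: "finite R"
    unfolding R_def using finC by auto
  have "card R \<le> card (C \<inter> F) + card (mid ` (C - F)) + card ?X2 +
      card ((\<lambda>(u, v, w). (u, v)) ` ?X3) + card ((\<lambda>(u, v, x, w). (u, v)) ` ?X4)"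
    unfolding R_def by (intro order_trans[OF card_Un_le] add_mono order_refl)
  also have "\<dots> \<le> card (C \<inter> F) + card (C - F) + card ?X2 + card ?X3 + card ?X4"
    using finC by (intro add_mono card_image_le order_refl) auto
  also have "card (C \<inter> F) + card (C - F) = card C"
    using card_Int_Diff[OF finC] by simp
  finally have card_R: "card R \<le> card C + card ?X2 + card ?X3 + card ?X4" .
  let ?H = "F - R"
  have no_path: "(v, w) \<notin> ?H" if uv: "(u, v) \<in> ?H" for u v w
  proof
    assume vw: "(v, w) \<in> ?H"
    have F2: "(u, v) \<in> F" "(v, w) \<in> F"
      using uv vw by auto
    have "w \<noteq> u"
    proof
      assume "w = u"
      then have "(u, v) \<in> ?X2"
        using F2 lt unfolding copies_def two_cycles_def two_cycle_arcs_def by auto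
      then show False
        using uv unfolding R_def by auto
    qed
    have notC: "(u, v) \<notin> C" "(v, w) \<notin> C"
      using uv vw F2 unfolding R_def by auto
    have path: "forward_path F u v w"
      using F2 lt \<open>w \<noteq> u\<close> unfolding forward_path_def by auto
    \<comment> \<open>\<open>C\<close> meets the triangle closed by the path but contains neither of
      the two path arcs.\<close>
    have "(w, u) \<in> C"
    proof (rule ccontr)
      assume "(w, u) \<notin> C"
      then have "{(u, v), (v, w), (w, u)} \<in> directed_triangles (?D\<lparr>parcs := parcs ?D - C\<rparr>)"
        using notC directed_triangle_of_forward_path[OF path]
        unfolding directed_triangles_remove by auto
      then show False
        using C unfolding triangle_arc_cover_def by auto
    qed
    show False
    proof (cases "(w, u) \<in> F")
      \<comment> \<open>A closing arc that is itself forward is not replaced by \<open>mid\<close>;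
        here \<open>(u, v)\<close> is in \<open>R\<close> as the first arc of a three-cycle.\<close>
      case True
      then have "(u, v, w) \<in> ?X3"
        using F2 lt \<open>w \<noteq> u\<close> unfolding copies_def three_cycles_def three_cycle_arcs_def by auto
      then have "(u, v) \<in> R"
        unfolding R_def by force
      then show False
        using uv by auto
    next
      case False
      \<comment> \<open>\<open>mid\<close> selects the first arc of a path through \<open>x\<close>.
        As \<open>(u, v)\<close> is not in \<open>R\<close>, \<open>x\<close> differs from
        \<open>v\<close>, and the resulting double path puts \<open>(u, v)\<close> into
        \<open>R\<close> after all.\<close>
      define x where "x = (SOME v. (u, v) \<in> F \<and> (v, w) \<in> F)"
      have x: "(u, x) \<in> F \<and> (x, w) \<in> F"
        unfolding x_def by (rule someI[of _ v]) (use F2 in auto)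
      have "mid (w, u) = (u, x)"
        unfolding mid_def x_def by simp
      then have "(u, x) \<in> R"
        using False \<open>(w, u) \<in> C\<close> unfolding R_def by force
      then have "x \<noteq> v"
        using uv by auto
      then have "(u, v, x, w) \<in> ?X4"
        using F2 x lt \<open>w \<noteq> u\<close> unfolding copies_def double_paths_def double_path_arcs_def by auto
      then have "(u, v) \<in> R"
        unfolding R_def by force
      then show False
        using uv by auto
    qed
  qed
  have "?H \<subseteq> F \<inter> Domain ?H \<times> ({..<n} - Domain ?H)"
    using path_free_subset_dicut[of ?H] no_path lt by blast
  then have "card ?H \<le> card (F \<inter> Domain ?H \<times> ({..<n} - Domain ?H))"
    using finF by (intro card_mono) auto
  also have "real \<dots> \<le> m"
    using lt by (intro cut) auto
  finally have "real (card ?H) \<le> m"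
    by simp
  moreover have "card F \<le> card ?H + card R"
    using finR by (metis add.commute card_mono card_Un_le finF finite_Un Un_Diff_cancel Un_upper2 le_trans)
  ultimately show ?thesis
    using card_R card_C by linarith
qed

section \<open>Lower bound for the packing number\<close>

text \<open>Both sets are cut down to the smaller size and joined by a bijection. Injective
  projections mean that no element is used twice.\<close>

lemma exists_matching:
  assumes "finite A" "finite B"
  obtains M where "M \<subseteq> A \<times> B" "card M = min (card A) (card B)" "inj_on fst M" "inj_on snd M"
proof -
  obtain A' where A': "A' \<subseteq> A" "card A' = min (card A) (card B)"
    by (meson min.cobounded1 obtain_subset_with_card_n)
  obtain B' where B': "B' \<subseteq> B" "card B' = min (card A) (card B)"
    by (meson min.cobounded2 obtain_subset_with_card_n)
  have "finite A'" "finite B'"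
    using A' B' assms finite_subset by blast+
  then obtain h where h: "bij_betw h A' B'"
    using A' B' finite_same_card_bij by metis
  let ?M = "(\<lambda>a. (a, h a)) ` A'"
  have "?M \<subseteq> A \<times> B"
    using A' B' h by (auto simp: bij_betw_def)
  moreover have "card ?M = min (card A) (card B)"
    using A' by (simp add: card_image inj_on_def)
  moreover have "inj_on fst ?M" "inj_on snd ?M"
    using h by (auto simp: inj_on_def bij_betw_def)
  ultimately show thesis
    using that by blast
qed

definition lower_in :: "(nat \<times> nat) set \<Rightarrow> nat \<Rightarrow> (nat \<times> nat) set" where
  "lower_in F v = F \<inter> {..<v} \<times> {v}"

definition lower_out :: "(nat \<times> nat) set \<Rightarrow> nat \<Rightarrow> (nat \<times> nat) set" where
  "lower_out F v = F \<inter> {v} \<times> {..<v}"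

lemma card_eq_sum_lower:
  assumes F: "F \<subseteq> arc_pairs n"
  shows "card F = (\<Sum>v<n. card (lower_in F v) + card (lower_out F v))"
proof -
  have finF: "finite F"
    using F by (rule finite_arcs)
  have "F = (\<Union>v<n. lower_in F v \<union> lower_out F v)"
  proof
    show "F \<subseteq> (\<Union>v<n. lower_in F v \<union> lower_out F v)"
    proof
      fix e assume e: "e \<in> F"
      obtain a b where ab: "e = (a, b)" by (cases e)
      then have "a < n" "b < n" "a \<noteq> b" using e F by auto
      then show "e \<in> (\<Union>v<n. lower_in F v \<union> lower_out F v)"
        using e ab unfolding lower_in_def lower_out_def by (cases "a < b") auto
    qed
  qed (auto simp: lower_in_def lower_out_def)
  then have "card F = card (\<Union>v<n. lower_in F v \<union> lower_out F v)"
    by simp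
  also have "\<dots> = (\<Sum>v<n. card (lower_in F v \<union> lower_out F v))"
    using finF by (intro card_UN_disjoint) (auto simp: lower_in_def lower_out_def)
  also have "\<dots> = (\<Sum>v<n. card (lower_in F v) + card (lower_out F v))"
    using finF by (intro sum.cong refl card_Un_disjoint) (auto simp: lower_in_def lower_out_def)
  finally show ?thesis .
qed

text \<open>In-arcs and out-arcs assigned to \<open>v\<close> are matched into paths. A path gives a
  triangle disjoint from the others unless it is a two-cycle, its closing arc is forward, or that
  arc closes a second forward path; the three counts bound these exceptions.\<close>

lemma nu_t_lower:
  assumes F: "F \<subseteq> arc_pairs n"
  shows "(\<Sum>v<n. min (card (lower_in F v)) (card (lower_out F v))) \<le>
    nu_t (closure_digraph n F) + card (copies (two_cycles n) two_cycle_arcs F) +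
    card (copies (three_cycles n) three_cycle_arcs F) +
    card (copies (double_paths n) double_path_arcs F)"
proof -
  let ?D = "closure_digraph n F"
  let ?X2 = "copies (two_cycles n) two_cycle_arcs F"
  let ?X3 = "copies (three_cycles n) three_cycle_arcs F"
  let ?X4 = "copies (double_paths n) double_path_arcs F"
  have finF: "finite F"
    using F by (rule finite_arcs)
  have lt: "a < n \<and> b < n \<and> a \<noteq> b" if "(a, b) \<in> F" for a b
    using arcs_lt[OF F that] .
  have "\<exists>M. M \<subseteq> lower_in F v \<times> lower_out F v \<and>
      card M = min (card (lower_in F v)) (card (lower_out F v)) \<and> inj_on fst M \<and> inj_on snd M" for v :: nat
    by (rule exists_matching[of "lower_in F v" "lower_out F v"])
       (use finF in \<open>auto simp: lower_in_def lower_out_def\<close>)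
  then obtain M where M: "\<And>v. M v \<subseteq> lower_in F v \<times> lower_out F v"
      "\<And>v. card (M v) = min (card (lower_in F v)) (card (lower_out F v))"
      "\<And>v. inj_on fst (M v)" "\<And>v. inj_on snd (M v)"
    by metis
  define P where "P = {(u, v, w). v < n \<and> ((u, v), (v, w)) \<in> M v}"
  have P: "(u, v) \<in> F" "(v, w) \<in> F" "u < v" "w < v" "v < n" if "(u, v, w) \<in> P" for u v w
    using that M(1)[of v] unfolding P_def lower_in_def lower_out_def by auto
  have finM: "finite (M v)" for v
    by (rule finite_subset[OF M(1)]) (use finF in \<open>auto simp: lower_in_def lower_out_def\<close>)
  have "card (\<Union>v<n. M v) = (\<Sum>v<n. card (M v))"
  proof (intro card_UN_disjoint ballI impI)
    fix v v' :: nat assume "v \<noteq> v'"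
    then show "M v \<inter> M v' = {}"
      using M(1)[of v] M(1)[of v'] unfolding lower_in_def by auto
  qed (use finM in auto)
  moreover have "(\<Union>v<n. M v) = (\<lambda>(u, v, w). ((u, v), (v, w))) ` P"
  proof
    show "(\<Union>v<n. M v) \<subseteq> (\<lambda>(u, v, w). ((u, v), (v, w))) ` P"
    proof
      fix e assume "e \<in> (\<Union>v<n. M v)"
      then obtain v where v: "v < n" "e \<in> M v" by auto
      then obtain u w where "e = ((u, v), (v, w))"
        using M(1)[of v] unfolding lower_in_def lower_out_def by auto
      then show "e \<in> (\<lambda>(u, v, w). ((u, v), (v, w))) ` P"
        using v unfolding P_def by force
    qed
  qed (auto simp: P_def)
  moreover have "inj_on (\<lambda>(u, v, w). ((u, v), (v, w))) P"
    by (auto simp: inj_on_def)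
  ultimately have card_P: "card P = (\<Sum>v<n. min (card (lower_in F v)) (card (lower_out F v)))"
    using M(2) by (simp add: card_image)
  \<comment> \<open>For a path in \<open>G\<close> the closing arc is not forward and determines the
    middle vertex.\<close>
  define G where "G = {(u, v, w) \<in> P. u \<noteq> w \<and> (w, u) \<notin> F \<and>
    (\<forall>x. (u, x) \<in> F \<and> (x, w) \<in> F \<longrightarrow> x = v)}"
  have G: "u \<noteq> w" "(w, u) \<notin> F" "\<And>x. (u, x) \<in> F \<Longrightarrow> (x, w) \<in> F \<Longrightarrow> x = v" "(u, v, w) \<in> P"
    if "(u, v, w) \<in> G" for u v w
    using that unfolding G_def by auto
  have finP: "finite P"
  proof (rule finite_subset)
    show "P \<subseteq> {..<n} \<times> {..<n} \<times> {..<n}"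
      using P lt by fastforce
  qed simp
  have finG: "finite G"
    using finP finite_subset[of G P] unfolding G_def by auto
  have "P \<subseteq> G \<union> (\<lambda>(u, v). (u, v, u)) ` ?X2 \<union> ?X3 \<union> (\<lambda>(u, v, x, w). (u, v, w)) ` ?X4"
  proof
    fix t assume t: "t \<in> P"
    obtain u v w where uvw: "t = (u, v, w)" by (cases t)
    note p = P[OF t[unfolded uvw]]
    consider "u = w" | "u \<noteq> w" "(w, u) \<in> F" | x where "u \<noteq> w" "(u, x) \<in> F" "(x, w) \<in> F" "x \<noteq> v"
      | "t \<in> G"
      using t uvw unfolding G_def by auto
    then show "t \<in> G \<union> (\<lambda>(u, v). (u, v, u)) ` ?X2 \<union> ?X3 \<union> (\<lambda>(u, v, x, w). (u, v, w)) ` ?X4"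
    proof cases
      case 1
      then have "(u, v) \<in> ?X2"
        using p lt unfolding copies_def two_cycles_def two_cycle_arcs_def by auto
      then show ?thesis
        using 1 uvw by force
    next
      case 2
      then have "(u, v, w) \<in> ?X3"
        using p lt unfolding copies_def three_cycles_def three_cycle_arcs_def by auto
      then show ?thesis
        using uvw by auto
    next
      case 3
      then have "(u, v, x, w) \<in> ?X4"
        using p lt unfolding copies_def double_paths_def double_path_arcs_def by auto
      then show ?thesis
        using uvw by force
    qed auto
  qed
  then have "card P \<le> card (G \<union> (\<lambda>(u, v). (u, v, u)) ` ?X2 \<union> ?X3 \<union> (\<lambda>(u, v, x, w). (u, v, w)) ` ?X4)"
    using finG by (intro card_mono) auto
  also have "\<dots> \<le> card G + card ((\<lambda>(u, v). (u, v, u)) ` ?X2) + card ?X3 +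
      card ((\<lambda>(u, v, x, w). (u, v, w)) ` ?X4)"
    by (intro order_trans[OF card_Un_le] add_mono order_refl)
  also have "\<dots> \<le> card G + card ?X2 + card ?X3 + card ?X4"
    by (intro add_mono card_image_le order_refl) auto
  finally have card_PG: "card P \<le> card G + card ?X2 + card ?X3 + card ?X4" .
  define tri where "tri = (\<lambda>(u :: nat, v :: nat, w :: nat). {(u, v), (v, w), (w, u)})"
  have disj: "g = g'" if g: "g \<in> G" "g' \<in> G" and "tri g \<inter> tri g' \<noteq> {}" for g g'
  proof -
    obtain u v w where e: "g = (u, v, w)" by (cases g)
    obtain u' v' w' where e': "g' = (u', v', w')" by (cases g')
    note i = G[OF g(1)[unfolded e]] and i' = G[OF g(2)[unfolded e']]
    note j = P[OF i(4)] and j' = P[OF i'(4)]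
    have m: "((u, v), (v, w)) \<in> M v" "((u', v'), (v', w')) \<in> M v'"
      using i(4) i'(4) unfolding P_def by auto
    have "(u, v) \<in> tri g' \<or> (v, w) \<in> tri g' \<or> (w, u) \<in> tri g'"
      using that(3) unfolding e tri_def by auto
    \<comment> \<open>Closing arcs are not in \<open>F\<close>, so a closing arc can only coincide
      with another closing arc.\<close>
    then have "(u, v) = (u', v') \<or> (v, w) = (v', w') \<or> (w, u) = (w', u') \<or>
        (u, v) = (v', w') \<or> (v, w) = (u', v')"
      using i(2) i'(2) j(1,2) j'(1,2) unfolding e' tri_def by force
    then consider "(u, v) = (u', v')" | "(v, w) = (v', w')" | "(w, u) = (w', u')"
      | "(u, v) = (v', w')" | "(v, w) = (u', v')"
      by blast
    then show ?thesis
    proof cases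
      \<comment> \<open>A shared arc in the same position fixes its partner, since
        \<open>fst\<close> and \<open>snd\<close> are injective on \<open>M v\<close>.\<close>
      case 1
      then have "((u, v), (v, w')) \<in> M v"
        using m(2) by simp
      then have "((u, v), (v, w)) = ((u, v), (v, w'))"
        using m(1) by (intro inj_onD[OF M(3)[of v]]) simp_all
      then show ?thesis using 1 e e' by simp
    next
      case 2
      then have "((u', v), (v, w)) \<in> M v"
        using m(2) by simp
      then have "((u, v), (v, w)) = ((u', v), (v, w))"
        using m(1) by (intro inj_onD[OF M(4)[of v]]) simp_all
      then show ?thesis using 2 e e' by simp
    next
      case 3
      \<comment> \<open>Both paths join \<open>u\<close> to \<open>w\<close>, and the middle vertex
        of such a path is unique.\<close>
      then have "v' = v"
        using i(3) j'(1,2) by auto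
      then show ?thesis using 3 e e' by auto
    next
      \<comment> \<open>First arcs lead to a larger vertex and second arcs to a smaller one, so an
        arc cannot have both roles.\<close>
      case 4
      then show ?thesis using j(3) j'(4) by auto
    next
      case 5
      then show ?thesis using j(4) j'(3) by auto
    qed
  qed
  have ne: "tri g \<noteq> {}" for g
    unfolding tri_def by (cases g) auto
  have "arc_disjoint_triangle_packing ?D (tri ` G)"
    unfolding arc_disjoint_triangle_packing_def
  proof
    show "tri ` G \<subseteq> directed_triangles ?D"
    proof
      fix t assume "t \<in> tri ` G"
      then obtain u v w where g: "(u, v, w) \<in> G" and t: "t = {(u, v), (v, w), (w, u)}"
        unfolding tri_def by auto
      note i = G[OF g]
      note j = P[OF i(4)]
      have "forward_path F u v w"
        using i(1) j unfolding forward_path_def by auto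
      then show "t \<in> directed_triangles ?D"
        using t directed_triangle_of_forward_path by simp
    qed
    show "pairwise disjnt (tri ` G)"
      unfolding pairwise_def disjnt_def using disj by blast
  qed
  then have "card (tri ` G) \<le> nu_t ?D"
    using nu_t_attained[OF finite_closure_arcs[OF F]] by metis
  \<comment> \<open>Equal triangles intersect because they are nonempty, so disjointness also yields
    injectivity.\<close>
  moreover have "inj_on tri G"
    using disj ne unfolding inj_on_def by (metis inf.idem)
  ultimately have "card G \<le> nu_t ?D"
    by (simp add: card_image)
  then show ?thesis
    using card_P card_PG by linarith
qed

section \<open>Random forward arcs\<close>

lemma forward_arcs_pmf_subset:
  assumes "F \<in> set_pmf (forward_arcs_pmf n p)"
  shows "F \<subseteq> arc_pairs n"
  using assms unfolding forward_arcs_pmf_def arc_pairs_def[symmetric]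
  by (auto dest!: subsetD[OF set_Pi_pmf_subset[OF finite_arc_pairs]])

lemma integrable_forward_arcs [simp]:
  fixes f :: "(nat \<times> nat) set \<Rightarrow> real"
  shows "integrable (measure_pmf (forward_arcs_pmf n p)) f"
proof (rule integrable_measure_pmf_finite)
  have "set_pmf (forward_arcs_pmf n p) \<subseteq> Pow (arc_pairs n)"
    using forward_arcs_pmf_subset by blast
  then show "finite (set_pmf (forward_arcs_pmf n p))"
    by (rule finite_subset) simp
qed

section \<open>Expected numbers of copies\<close>

text \<open>Independence in a form with two uses: \<open>a = 1\<close>, \<open>b = 0\<close> gives
  the indicator of \<open>A \<subseteq> F\<close>, and \<open>a = exp l\<close>,
  \<open>b = 1\<close> gives the moment generating function of
  \<open>card (F \<inter> A)\<close>.\<close>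

lemma expectation_forward_arcs_prod:
  fixes a b p :: real
  assumes "0 \<le> p" "p \<le> 1" "0 \<le> a" "0 \<le> b" and A: "A \<subseteq> arc_pairs n"
  shows "measure_pmf.expectation (forward_arcs_pmf n p) (\<lambda>F. \<Prod>e\<in>A. if e \<in> F then a else b) =
    (p * a + (1 - p) * b) ^ card A"
proof -
  \<comment> \<open>Arcs outside \<open>A\<close> get the factor 1, so the product runs over the
    whole index set of \<open>Pi_pmf\<close>.\<close>
  define g where "g = (\<lambda>e v. if e \<in> A then if v then a else b else 1)"
  have g: "(\<Prod>e\<in>A. if X e then a else b) = (\<Prod>e\<in>arc_pairs n. g e (X e))" for X
    unfolding g_def using A by (intro prod.mono_neutral_cong_left) auto
  have "measure_pmf.expectation (forward_arcs_pmf n p) (\<lambda>F. \<Prod>e\<in>A. if e \<in> F then a else b) =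
      measure_pmf.expectation (Pi_pmf (arc_pairs n) False (\<lambda>_. bernoulli_pmf p))
        (\<lambda>X. \<Prod>e\<in>A. if X e then a else b)"
    unfolding forward_arcs_pmf_def arc_pairs_def[symmetric] by simp
  also have "\<dots> =
      (\<Prod>e\<in>arc_pairs n. measure_pmf.expectation (bernoulli_pmf p) (g e))"
    unfolding g using assms
    by (intro expectation_prod_Pi_pmf) (auto simp: g_def intro!: integrable_measure_pmf_finite)
  also have "\<dots> = (\<Prod>e\<in>A. p * a + (1 - p) * b)"
    using A assms(1,2) by (intro prod.mono_neutral_cong_right) (auto simp: g_def)
  finally show ?thesis
    by simp
qed

lemma expectation_card_copies:
  fixes p :: real
  assumes p: "0 \<le> p" "p \<le> 1" and I: "finite I"
    and A: "\<And>i. i \<in> I \<Longrightarrow> A i \<subseteq> arc_pairs n \<and> card (A i) = k"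
  shows "measure_pmf.expectation (forward_arcs_pmf n p) (\<lambda>F. real (card (copies I A F))) =
    real (card I) * p ^ k"
proof -
  have fin: "finite (A i)" if "i \<in> I" for i
    using A[OF that] finite_arcs by auto
  have eq: "real (card (copies I A F)) = (\<Sum>i\<in>I. \<Prod>e\<in>A i. if e \<in> F then 1 else 0)" for F
  proof -
    have "(\<Sum>i\<in>I. \<Prod>e\<in>A i. if e \<in> F then 1 else 0 :: real) = (\<Sum>i\<in>I. if A i \<subseteq> F then 1 else 0)"
    proof (intro sum.cong refl)
      fix i assume "i \<in> I"
      then show "(\<Prod>e\<in>A i. if e \<in> F then 1 else 0 :: real) = (if A i \<subseteq> F then 1 else 0)"
        using fin by (cases "A i \<subseteq> F") (auto intro!: prod.neutral)
    qed
    also have "\<dots> = real (card {i \<in> I. A i \<subseteq> F})"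
      using I by (simp add: sum.If_cases Int_def)
    finally show ?thesis
      by (simp add: copies_def)
  qed
  have "measure_pmf.expectation (forward_arcs_pmf n p) (\<lambda>F. real (card (copies I A F))) =
      (\<Sum>i\<in>I. measure_pmf.expectation (forward_arcs_pmf n p) (\<lambda>F. \<Prod>e\<in>A i. if e \<in> F then 1 else 0))"
    unfolding eq by (subst Bochner_Integration.integral_sum) auto
  also have "\<dots> = (\<Sum>i\<in>I. p ^ k)"
  proof (intro sum.cong refl)
    fix i assume "i \<in> I"
    then show "measure_pmf.expectation (forward_arcs_pmf n p) (\<lambda>F. \<Prod>e\<in>A i. if e \<in> F then 1 else 0) = p ^ k"
      using expectation_forward_arcs_prod[OF p, of 1 0 "A i" n] A by auto
  qed
  finally show ?thesis
    by simp
qed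

section \<open>Deviation of arc counts from their means\<close>

definition deviation :: "real \<Rightarrow> (nat \<times> nat) set \<Rightarrow> (nat \<times> nat) set \<Rightarrow> real" where
  "deviation p A F = \<bar>real (card (F \<inter> A)) - p * real (card A)\<bar>"

text \<open>This is the binomial variance without its factor \<open>1 - p\<close>. The squared count
  is expanded over ordered pairs of arcs, whose diagonal is the count itself.\<close>

lemma expectation_deviation_square_le:
  fixes p :: real
  assumes p: "0 \<le> p" "p \<le> 1" and A: "A \<subseteq> arc_pairs n"
  shows "measure_pmf.expectation (forward_arcs_pmf n p) (\<lambda>F. (deviation p A F)\<^sup>2) \<le> p * card A"
proof -
  let ?E = "measure_pmf.expectation (forward_arcs_pmf n p)"
  let ?a = "real (card A)"
  have finA: "finite A"
    using A by (rule finite_arcs)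
  let ?I = "A \<times> A - Id" and ?pair = "\<lambda>(e, e'). {e, e'}"
  have diag: "(A \<times> A) \<inter> Id = (\<lambda>e. (e, e)) ` A"
    by auto
  have "card (A \<times> A) = card ((A \<times> A) \<inter> Id) + card ?I"
    by (rule card_Int_Diff) (use finA in simp)
  also have "card ((A \<times> A) \<inter> Id) = card A"
    unfolding diag by (rule card_image) (simp add: inj_on_def)
  finally have "real (card A * card A) = real (card A + card ?I)"
    unfolding card_cartesian_product by (rule arg_cong)
  then have cardI: "real (card ?I) = ?a\<^sup>2 - ?a"
    by (simp add: power2_eq_square)
  have E1: "?E (\<lambda>F. real (card (F \<inter> A))) = ?a * p"
  proof -
    have "F \<inter> A = copies A (\<lambda>e. {e}) F" for F
      unfolding copies_def by auto
    then show ?thesis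
      using expectation_card_copies[OF p finA, of "\<lambda>e. {e}" n 1] A by auto
  qed
  \<comment> \<open>Two distinct arcs form a configuration of size 2, so this second factorial
    moment is an expected number of copies.\<close>
  have E2: "?E (\<lambda>F. real (card (copies ?I ?pair F))) = (?a\<^sup>2 - ?a) * p\<^sup>2"
    unfolding cardI[symmetric]
  proof (rule expectation_card_copies[OF p])
    fix i assume i: "i \<in> ?I"
    obtain e e' where e: "i = (e, e')"
      by (cases i)
    then have "e \<noteq> e'" "e \<in> A" "e' \<in> A"
      using i by auto
    then show "?pair i \<subseteq> arc_pairs n \<and> card (?pair i) = 2"
      using A e by (simp add: subsetD)
  qed (use finA in simp)
  have sq: "(real (card (F \<inter> A)))\<^sup>2 = real (card (F \<inter> A)) + real (card (copies ?I ?pair F))" for F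
  proof -
    let ?B = "F \<inter> A"
    have "card (?B \<times> ?B) = card ((?B \<times> ?B) \<inter> Id) + card (?B \<times> ?B - Id)"
      by (rule card_Int_Diff) (use finA in simp)
    also have "(?B \<times> ?B) \<inter> Id = (\<lambda>e. (e, e)) ` ?B"
      by auto
    also have "card \<dots> = card ?B"
      by (rule card_image) (simp add: inj_on_def)
    also have "?B \<times> ?B - Id = copies ?I ?pair F"
      unfolding copies_def by auto
    finally show ?thesis
      unfolding card_cartesian_product power2_eq_square of_nat_mult[symmetric] by simp
  qed
  have "(deviation p A F)\<^sup>2 = (1 - 2 * p * ?a) * real (card (F \<inter> A)) +
      real (card (copies ?I ?pair F)) + (p * ?a)\<^sup>2" for F
  proof -
    have "(deviation p A F)\<^sup>2 = (real (card (F \<inter> A)))\<^sup>2 - 2 * p * ?a * real (card (F \<inter> A)) + (p * ?a)\<^sup>2"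
      unfolding deviation_def power2_abs power2_diff by (simp add: algebra_simps)
    then show ?thesis
      unfolding sq by (simp add: algebra_simps)
  qed
  then have "?E (\<lambda>F. (deviation p A F)\<^sup>2) =
      (1 - 2 * p * ?a) * (?a * p) + (?a\<^sup>2 - ?a) * p\<^sup>2 + (p * ?a)\<^sup>2"
    using E1 E2 by simp
  also have "\<dots> = p * ?a - p\<^sup>2 * ?a"
    by (simp add: algebra_simps power2_eq_square)
  also have "\<dots> \<le> p * ?a"
    by simp
  finally show ?thesis .
qed

text \<open>Here \<open>s\<close> bounds the standard deviation; the inequality
  \<open>2 * s * x \<le> x^2 + s^2\<close> takes the place of Cauchy-Schwarz.\<close>

lemma expectation_deviation_le:
  fixes p :: real
  assumes p: "0 \<le> p" "p \<le> 1" and A: "A \<subseteq> arc_pairs n"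
    and s: "0 < s" "p * card A \<le> s\<^sup>2"
  shows "measure_pmf.expectation (forward_arcs_pmf n p) (deviation p A) \<le> s"
proof -
  let ?E = "measure_pmf.expectation (forward_arcs_pmf n p)"
  have "?E (deviation p A) \<le> ?E (\<lambda>F. (deviation p A F)\<^sup>2 / (2 * s) + s / 2)"
  proof (rule integral_mono)
    fix F
    have "0 \<le> (deviation p A F - s)\<^sup>2"
      by simp
    then show "deviation p A F \<le> (deviation p A F)\<^sup>2 / (2 * s) + s / 2"
      using s(1) by (simp add: field_simps power2_eq_square)
  qed auto
  also have "\<dots> = ?E (\<lambda>F. (deviation p A F)\<^sup>2) / (2 * s) + s / 2"
    by simp
  also have "\<dots> \<le> s\<^sup>2 / (2 * s) + s / 2"
    using expectation_deviation_square_le[OF p A] s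
    by (intro add_mono divide_right_mono) auto
  also have "\<dots> = s"
    using s(1) by (simp add: field_simps power2_eq_square)
  finally show ?thesis .
qed

section \<open>Chernoff and union bound for directed cuts\<close>

text \<open>Markov's inequality is applied to the exponential of \<open>l\<close> times the number
  of cut arcs. A cut has at most \<open>n^2 / 4\<close> possible arcs, so the terms linear in
  \<open>l\<close> other than \<open>l * t\<close> cancel.\<close>

lemma prob_dicut_large:
  fixes p :: real
  assumes p: "0 \<le> p" "p \<le> 1" and l: "0 < l" "l \<le> 1" and S: "S \<subseteq> {..<n}"
  shows "measure_pmf.prob (forward_arcs_pmf n p)
      {F. p * real n ^ 2 / 4 + t \<le> real (card (F \<inter> S \<times> ({..<n} - S)))} \<le>
    exp (l\<^sup>2 * p * real n ^ 2 / 4 - l * t)"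
proof -
  let ?M = "forward_arcs_pmf n p"
  let ?A = "S \<times> ({..<n} - S)"
  let ?X = "\<lambda>F. exp (l * real (card (F \<inter> ?A)))"
  have A: "?A \<subseteq> arc_pairs n"
    using S by auto
  have finS: "finite S"
    using S finite_subset by auto
  have "card S \<le> n"
    using card_mono[OF _ S] by simp
  then have "real (card ?A) = real (card S) * (real n - real (card S))"
    using finS S by (simp add: card_cartesian_product card_Diff_subset of_nat_diff)
  also have "\<dots> = real n ^ 2 / 4 - (real (card S) - real n / 2)\<^sup>2"
    by (simp add: power2_eq_square field_simps)
  also have "\<dots> \<le> real n ^ 2 / 4"
    by simp
  finally have cardA: "real (card ?A) \<le> real n ^ 2 / 4" .
  have "?X F = (\<Prod>e\<in>?A. if e \<in> F then exp l else 1)" for F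
  proof -
    have "(\<Prod>e\<in>?A. if e \<in> F then exp l else 1) = (\<Prod>e\<in>?A \<inter> F. exp l)"
      using finS by (simp add: prod.If_cases Int_def)
    then show ?thesis
      by (simp add: exp_of_nat_mult[symmetric] Int_commute mult.commute)
  qed
  then have "measure_pmf.expectation ?M ?X = (p * exp l + (1 - p) * 1) ^ card ?A"
    using expectation_forward_arcs_prod[OF p, of "exp l" 1 ?A n] A by simp
  also have "\<dots> = (1 + p * (exp l - 1)) ^ card ?A"
    by (simp add: algebra_simps)
  also have "\<dots> \<le> exp (p * (l + l\<^sup>2)) ^ card ?A"
  proof (rule power_mono)
    \<comment> \<open>For \<open>l\<close> between 0 and 1, \<open>exp l\<close> is at most
      \<open>1 + l + l^2\<close>.\<close>
    have "p * (exp l - 1) \<le> p * (l + l\<^sup>2)"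
      using exp_bound[of l] l p by (intro mult_left_mono) auto
    then show "1 + p * (exp l - 1) \<le> exp (p * (l + l\<^sup>2))"
      using exp_ge_add_one_self[of "p * (l + l\<^sup>2)"] by linarith
    show "0 \<le> 1 + p * (exp l - 1)"
      using p l by simp
  qed
  also have "\<dots> = exp (real (card ?A) * (p * (l + l\<^sup>2)))"
    by (simp add: exp_of_nat_mult)
  also have "\<dots> \<le> exp (real n ^ 2 / 4 * (p * (l + l\<^sup>2)))"
    using cardA p l by (intro exp_le_cancel_iff[THEN iffD2] mult_right_mono) auto
  finally have E: "measure_pmf.expectation ?M ?X \<le> exp (real n ^ 2 / 4 * (p * (l + l\<^sup>2)))" .
  have "{F. p * real n ^ 2 / 4 + t \<le> real (card (F \<inter> ?A))} =
      {F \<in> space ?M. exp (l * (p * real n ^ 2 / 4 + t)) \<le> ?X F}"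
    using l by auto
  then have "measure_pmf.prob ?M {F. p * real n ^ 2 / 4 + t \<le> real (card (F \<inter> ?A))} \<le>
      measure_pmf.expectation ?M ?X / exp (l * (p * real n ^ 2 / 4 + t))"
    using integral_Markov_inequality_measure[of ?M ?X "{}" "exp (l * (p * real n ^ 2 / 4 + t))"]
    by (simp add: Collect_conj_eq)
  also have "\<dots> \<le> exp (real n ^ 2 / 4 * (p * (l + l\<^sup>2))) / exp (l * (p * real n ^ 2 / 4 + t))"
    using E by (intro divide_right_mono) auto
  also have "\<dots> = exp (l\<^sup>2 * p * real n ^ 2 / 4 - l * t)"
    unfolding exp_diff[symmetric] by (simp add: algebra_simps)
  finally show ?thesis .
qed

text \<open>The choice \<open>l = 1 / sqrt (n p)\<close>, at most 1 by \<open>d\<close>, gives the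
  exponent \<open>n / 4 - 2 n\<close> for each \<open>S\<close>. The union bound over
  \<open>2 ^ n\<close> sets costs a factor of at most \<open>exp n\<close>.\<close>

lemma prob_exists_dicut_large:
  fixes p :: real
  assumes p: "0 \<le> p" "p \<le> 1" and d: "1 \<le> real n * p"
  shows "measure_pmf.prob (forward_arcs_pmf n p)
      {F. \<exists>S\<subseteq>{..<n}. p * real n ^ 2 / 4 + 2 * real n * sqrt (real n * p) \<le>
        real (card (F \<inter> S \<times> ({..<n} - S)))} \<le> exp (- 3 / 4 * real n)"
    (is "measure_pmf.prob ?M ?B \<le> _")
proof -
  let ?t = "2 * real n * sqrt (real n * p)"
  let ?l = "1 / sqrt (real n * p)"
  let ?C = "\<lambda>S. {F. p * real n ^ 2 / 4 + ?t \<le> real (card (F \<inter> S \<times> ({..<n} - S)))}"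
  have pos: "0 < real n * p"
    using d by simp
  have l: "0 < ?l" "?l \<le> 1"
    using d by auto
  have np: "0 < n" "0 < p"
    using pos p by (auto simp: zero_less_mult_iff)
  have expo: "?l\<^sup>2 * p * real n ^ 2 / 4 - ?l * ?t = - 7 / 4 * real n"
    using pos np by (simp add: power_divide real_sqrt_pow2 field_simps power2_eq_square)
  have "?B = (\<Union>S\<in>Pow {..<n}. ?C S)"
    by auto
  then have "measure_pmf.prob ?M ?B \<le> (\<Sum>S\<in>Pow {..<n}. measure_pmf.prob ?M (?C S))"
    using measure_pmf.finite_measure_subadditive_finite[of "Pow {..<n}" ?C ?M] by simp
  also have "\<dots> \<le> (\<Sum>S\<in>Pow {..<n}. exp (- 7 / 4 * real n))"
    using prob_dicut_large[OF p l, of _ n ?t] unfolding expo by (intro sum_mono) auto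
  also have "\<dots> = 2 ^ n * exp (- 7 / 4 * real n)"
    by (simp add: card_Pow)
  also have "\<dots> \<le> exp 1 ^ n * exp (- 7 / 4 * real n)"
    using exp_ge_add_one_self[of 1] by (intro mult_right_mono power_mono) auto
  also have "\<dots> = exp (- 3 / 4 * real n)"
    by (simp add: exp_of_nat_mult[symmetric] exp_add[symmetric])
  finally show ?thesis .
qed

section \<open>Packing and covering numbers with high probability\<close>

text \<open>The sets whose arc counts must concentrate: all pairs, the cut into halves, and the two
  stars from each vertex to smaller ones. A single sum allows a single use of Markov's
  inequality.\<close>

definition total_deviation :: "nat \<Rightarrow> real \<Rightarrow> (nat \<times> nat) set \<Rightarrow> real" where
  "total_deviation n p F =
     deviation p (arc_pairs n) F + deviation p ({..<n div 2} \<times> {n div 2..<n}) F +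
     (\<Sum>v<n. deviation p ({..<v} \<times> {v}) F + deviation p ({v} \<times> {..<v}) F)"

definition config_count :: "nat \<Rightarrow> (nat \<times> nat) set \<Rightarrow> real" where
  "config_count n F =
     real (card (copies (two_cycles n) two_cycle_arcs F)) +
     real (card (copies (three_cycles n) three_cycle_arcs F)) +
     real (card (copies (double_paths n) double_path_arcs F)) +
     real (card (copies (pentagons n) pentagon_arcs F)) +
     real (card (copies (hexagons n) hexagon_arcs F))"

lemma card_arc_pairs: "real (card (arc_pairs n)) = real n ^ 2 - real n"
proof -
  have "arc_pairs n = {..<n} \<times> {..<n} - (\<lambda>v. (v, v)) ` {..<n}"
    by (auto simp: arc_pairs_def)
  moreover have "card ((\<lambda>v. (v, v)) ` {..<n}) = n"
    by (subst card_image) (auto simp: inj_on_def)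
  ultimately have "card (arc_pairs n) = n * n - n"
    by (subst \<open>arc_pairs n = _\<close>, subst card_Diff_subset) (auto simp: card_cartesian_product)
  then show ?thesis
    by (simp add: of_nat_diff power2_eq_square)
qed

lemma deviation_nonneg: "0 \<le> deviation p A F"
  by (simp add: deviation_def)

lemma abs_nu_t_le:
  fixes p :: real
  assumes F: "F \<subseteq> arc_pairs n" and p: "0 \<le> p" "p \<le> 1"
  shows "\<bar>real (nu_t (closure_digraph n F)) - p * real n ^ 2 / 2\<bar> \<le>
    total_deviation n p F + config_count n F + real n * p"
proof -
  let ?N = "real (card F)" and ?nu = "real (nu_t (closure_digraph n F))"
  let ?a = "\<lambda>v. real (card (lower_in F v))" and ?b = "\<lambda>v. real (card (lower_out F v))"
  let ?s = "\<Sum>v<n. deviation p ({..<v} \<times> {v}) F + deviation p ({v} \<times> {..<v}) F"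
  have "F \<inter> arc_pairs n = F"
    using F by auto
  then have N: "deviation p (arc_pairs n) F = \<bar>?N - (p * real n ^ 2 - real n * p)\<bar>"
    unfolding deviation_def card_arc_pairs by (simp add: algebra_simps)
  \<comment> \<open>Twice a minimum is the sum minus the difference. The difference is at most two
    deviations, as both stars at \<open>v\<close> have mean \<open>v * p\<close>.\<close>
  have s: "?N - ?s \<le> 2 * (\<Sum>v<n. min (?a v) (?b v))"
  proof -
    have "?N - ?s = (\<Sum>v<n. ?a v + ?b v - (deviation p ({..<v} \<times> {v}) F + deviation p ({v} \<times> {..<v}) F))"
      unfolding card_eq_sum_lower[OF F] by (simp add: sum_subtractf)
    also have "\<dots> \<le> (\<Sum>v<n. 2 * min (?a v) (?b v))"
      by (intro sum_mono)
         (auto simp: deviation_def lower_in_def lower_out_def card_cartesian_product min_def)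
    finally show ?thesis
      by (simp add: sum_distrib_left)
  qed
  have s0: "0 \<le> ?s"
    by (intro sum_nonneg add_nonneg_nonneg deviation_nonneg)
  have l: "(\<Sum>v<n. min (?a v) (?b v)) \<le> ?nu +
      real (card (copies (two_cycles n) two_cycle_arcs F)) +
      real (card (copies (three_cycles n) three_cycle_arcs F)) +
      real (card (copies (double_paths n) double_path_arcs F))"
    using of_nat_mono[OF nu_t_lower[OF F], where 'a = real]
    unfolding of_nat_add of_nat_sum of_nat_min .
  have u: "2 * ?nu \<le> ?N + 2 * (real (card (copies (pentagons n) pentagon_arcs F)) +
      real (card (copies (hexagons n) hexagon_arcs F)))"
    using of_nat_mono[OF nu_t_upper[OF F], where 'a = real]
    unfolding of_nat_add of_nat_mult of_nat_numeral .
  have np: "0 \<le> real n * p"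
    using p by simp
  have N': "?N - (p * real n ^ 2 - real n * p) \<le> deviation p (arc_pairs n) F"
      "(p * real n ^ 2 - real n * p) - ?N \<le> deviation p (arc_pairs n) F"
    unfolding N by linarith+
  have "\<bar>x - q / 2\<bar> \<le> D + D' + S + (x2 + x3 + x4 + x5 + x6) + d"
    if "N - (q - d) \<le> D" "(q - d) - N \<le> D" "N - S \<le> 2 * m" "m \<le> x + x2 + x3 + x4"
      "2 * x \<le> N + 2 * (x5 + x6)"
      "0 \<le> S" "0 \<le> D'" "0 \<le> d" "0 \<le> x2" "0 \<le> x3" "0 \<le> x4" "0 \<le> x5" "0 \<le> x6"
    for x q d D D' S N m x2 x3 x4 x5 x6 :: real
    using that by (simp add: abs_le_iff)
  from this[OF N' s l u s0 deviation_nonneg np] show ?thesis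
    unfolding total_deviation_def config_count_def by simp
qed

lemma abs_tau_t_le:
  fixes p :: real
  assumes F: "F \<subseteq> arc_pairs n" and p: "0 \<le> p" "p \<le> 1"
    and cut: "\<And>S. S \<subseteq> {..<n} \<Longrightarrow> real (card (F \<inter> S \<times> ({..<n} - S))) \<le> p * real n ^ 2 / 4 + t"
    and t: "0 \<le> t"
  shows "\<bar>real (tau_t (closure_digraph n F)) - 3 * p * real n ^ 2 / 4\<bar> \<le>
    total_deviation n p F + config_count n F + real n * p + p + t"
proof -
  let ?N = "real (card F)" and ?tau = "real (tau_t (closure_digraph n F))"
  let ?A = "{..<n div 2} \<times> {n div 2..<n}"
  let ?s = "\<Sum>v<n. deviation p ({..<v} \<times> {v}) F + deviation p ({v} \<times> {..<v}) F"
  have "F \<inter> arc_pairs n = F"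
    using F by auto
  then have N: "deviation p (arc_pairs n) F = \<bar>?N - (p * real n ^ 2 - real n * p)\<bar>"
    unfolding deviation_def card_arc_pairs by (simp add: algebra_simps)
  \<comment> \<open>For odd \<open>n\<close> the product of the two halves is
    \<open>(n^2 - 1) / 4\<close>; this rounding accounts for the summand \<open>p\<close> of the
    error.\<close>
  have cardA: "real n ^ 2 / 4 - 1 \<le> real (card ?A)"
  proof -
    define k where "k = n div 2"
    have k: "n = 2 * k \<or> n = 2 * k + 1"
      unfolding k_def by presburger
    have "real (card ?A) = real k * (real n - real k)"
      unfolding card_cartesian_product k_def[symmetric] using k by (auto simp: of_nat_diff)
    then show ?thesis
      using k by (auto simp: power2_eq_square field_simps)
  qed
  have "F \<inter> {..<n div 2} \<times> (- {..<n div 2}) = F \<inter> ?A"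
    using arcs_lt[OF F] by force
  then have u: "?tau + real (card (F \<inter> ?A)) \<le> ?N +
      (real (card (copies (pentagons n) pentagon_arcs F)) + real (card (copies (hexagons n) hexagon_arcs F)))"
    using tau_t_upper[OF F, of "{..<n div 2}"] by (simp flip: of_nat_add)
  have pA: "p * (real n ^ 2 / 4 - 1) \<le> p * real (card ?A)"
    using cardA p by (intro mult_left_mono) auto
  have ineq: "p * y / 4 - p - \<bar>x - c\<bar> \<le> x" if "p * (y / 4 - 1) \<le> c" for x c y
    using that by (simp add: right_diff_distrib)
  have A: "p * real n ^ 2 / 4 - p - deviation p ?A F \<le> real (card (F \<inter> ?A))"
    using ineq[OF pA, of "real (card (F \<inter> ?A))"]
    unfolding deviation_def .
  have s0: "0 \<le> ?s"
    by (intro sum_nonneg add_nonneg_nonneg deviation_nonneg)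
  have np: "0 \<le> real n * p"
    using p by simp
  have N': "?N - (p * real n ^ 2 - real n * p) \<le> deviation p (arc_pairs n) F"
      "(p * real n ^ 2 - real n * p) - ?N \<le> deviation p (arc_pairs n) F"
    unfolding N by linarith+
  have l: "?N \<le> ?tau + (p * real n ^ 2 / 4 + t) +
      card (copies (two_cycles n) two_cycle_arcs F) +
      card (copies (three_cycles n) three_cycle_arcs F) +
      card (copies (double_paths n) double_path_arcs F)"
    by (rule tau_t_lower[OF F cut])
  have "\<bar>x - 3 * p * r / 4\<bar> \<le> D + D' + S + (x2 + x3 + x4 + x5 + x6) + d + p + t"
    if "N - (p * r - d) \<le> D" "(p * r - d) - N \<le> D" "x + c \<le> N + (x5 + x6)"
      "p * r / 4 - p - D' \<le> c" "N \<le> x + (p * r / 4 + t) + x2 + x3 + x4"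
      "0 \<le> S" "0 \<le> D'" "0 \<le> d" "0 \<le> x2" "0 \<le> x3" "0 \<le> x4" "0 \<le> x5" "0 \<le> x6"
    for x r d D D' S N c x2 x3 x4 x5 x6 :: real
    using that p t by (simp add: abs_le_iff)
  from this[OF N' u A l s0 deviation_nonneg np] show ?thesis
    unfolding total_deviation_def config_count_def by simp
qed

section \<open>Expected errors and conclusion\<close>

text \<open>Each of the \<open>2 n\<close> stars has at most \<open>n\<close> arcs and standard
  deviation at most \<open>sqrt (n p)\<close>. For the two large sets the bound
  \<open>n sqrt p\<close> is relaxed to \<open>n sqrt (n p)\<close>.\<close>

lemma expectation_total_deviation_le:
  fixes p :: real
  assumes p: "0 \<le> p" "p \<le> 1" and d: "1 \<le> real n * p"
  shows "measure_pmf.expectation (forward_arcs_pmf n p) (total_deviation n p) \<le>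
    4 * (real n * sqrt (real n * p))"
proof -
  let ?E = "measure_pmf.expectation (forward_arcs_pmf n p)"
  let ?r = "sqrt (real n * p)"
  have n: "1 \<le> real n" and r: "1 \<le> ?r"
    using d by (cases n; simp)+
  have r2: "?r\<^sup>2 = real n * p"
    using d by simp
  have pairs: "?E (deviation p A) \<le> real n * ?r" if A: "A \<subseteq> arc_pairs n" for A
  proof (rule expectation_deviation_le[OF p A])
    show "0 < real n * ?r"
      using n r by simp
    have "card A \<le> card ({..<n} \<times> {..<n})"
      using A arc_pairs_subset by (intro card_mono) auto
    then have "real (card A) \<le> real n * real n"
      by (simp add: card_cartesian_product flip: of_nat_mult)
    then have "p * real (card A) \<le> p * (real n * real n)"
      using p by (intro mult_left_mono)
    also have "\<dots> \<le> p * (real n * real n) * real n"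
      using mult_left_mono[OF n, of "p * (real n * real n)"] p by simp
    also have "\<dots> = (real n * ?r)\<^sup>2"
      unfolding power_mult_distrib r2 by (simp add: power2_eq_square)
    finally show "p * real (card A) \<le> (real n * ?r)\<^sup>2" .
  qed
  have star: "?E (deviation p A) \<le> ?r" if A: "A \<subseteq> arc_pairs n" and c: "card A \<le> n" for A
  proof (rule expectation_deviation_le[OF p A])
    have "p * real (card A) \<le> p * real n"
      using c p by (intro mult_left_mono) simp_all
    then show "p * real (card A) \<le> ?r\<^sup>2"
      unfolding r2 by (simp add: mult.commute)
  qed (use r in simp)
  have "?E (total_deviation n p) =
      ?E (deviation p (arc_pairs n)) + ?E (deviation p ({..<n div 2} \<times> {n div 2..<n})) +
      (\<Sum>v<n. ?E (deviation p ({..<v} \<times> {v})) + ?E (deviation p ({v} \<times> {..<v})))"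
    unfolding total_deviation_def by simp
  also have "\<dots> \<le> real n * ?r + real n * ?r + (\<Sum>v<n. ?r + ?r)"
    by (intro add_mono sum_mono pairs star) (auto simp: card_cartesian_product)
  finally show ?thesis
    by simp
qed

lemma expectation_config_count_le:
  fixes p :: real
  assumes p: "0 \<le> p" "p \<le> 1" and d: "1 \<le> real n * p"
  shows "measure_pmf.expectation (forward_arcs_pmf n p) (config_count n) \<le> 5 * (real n * p) ^ 6"
proof -
  let ?E = "measure_pmf.expectation (forward_arcs_pmf n p)"
  have bound: "?E (\<lambda>F. real (card (copies I A F))) \<le> (real n * p) ^ 6"
    if "finite I" "\<And>i. i \<in> I \<Longrightarrow> A i \<subseteq> arc_pairs n \<and> card (A i) = k" "card I \<le> n ^ k" "k \<le> 6"
    for I :: "'i set" and A k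
  proof -
    have "?E (\<lambda>F. real (card (copies I A F))) = real (card I) * p ^ k"
      by (rule expectation_card_copies[OF p that(1,2)])
    also have "\<dots> \<le> real (n ^ k) * p ^ k"
      using that(3) p by (intro mult_right_mono) (auto simp del: of_nat_power)
    also have "\<dots> = (real n * p) ^ k"
      by (simp add: power_mult_distrib)
    also have "\<dots> \<le> (real n * p) ^ 6"
      using d that(4) by (intro power_increasing)
    finally show ?thesis .
  qed
  have "?E (config_count n) =
     ?E (\<lambda>F. real (card (copies (two_cycles n) two_cycle_arcs F))) +
     ?E (\<lambda>F. real (card (copies (three_cycles n) three_cycle_arcs F))) +
     ?E (\<lambda>F. real (card (copies (double_paths n) double_path_arcs F))) +
     ?E (\<lambda>F. real (card (copies (pentagons n) pentagon_arcs F))) +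
     ?E (\<lambda>F. real (card (copies (hexagons n) hexagon_arcs F)))"
    unfolding config_count_def by simp
  also have "\<dots> \<le> (real n * p) ^ 6 + (real n * p) ^ 6 + (real n * p) ^ 6 + (real n * p) ^ 6 + (real n * p) ^ 6"
    by (intro add_mono;
        rule bound[OF _ config_arcs(1) card_config_le(1)] bound[OF _ config_arcs(2) card_config_le(2)]
          bound[OF _ config_arcs(3) card_config_le(3)] bound[OF _ config_arcs(4) card_config_le(4)]
          bound[OF _ config_arcs(5) card_config_le(5)]; simp)
  finally show ?thesis
    by simp
qed

lemma random_digraph_eq: "random_digraph n p = map_pmf (closure_digraph n) (forward_arcs_pmf n p)"
  unfolding random_digraph_def closure_digraph_def ..

text \<open>There are two bad events: a total error of at least \<open>z\<close>, controlled by
  Markov's inequality, and a directed cut that is too large. Outside both, the deterministic bounds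
  hold with the common error \<open>b\<close>.\<close>

lemma prob_random_digraph_ge:
  fixes p z :: real
  assumes p: "0 \<le> p" "p \<le> 1" and d: "1 \<le> real n * p" and z: "0 < z"
  defines "b \<equiv> z + real n * p + p + 2 * real n * sqrt (real n * p)"
  shows "measure_pmf.prob (random_digraph n p)
      {D. \<bar>real (nu_t D) - p * real n ^ 2 / 2\<bar> \<le> b \<and> \<bar>real (tau_t D) - 3 * p * real n ^ 2 / 4\<bar> \<le> b} \<ge>
    1 - ((4 * (real n * sqrt (real n * p)) + 5 * (real n * p) ^ 6) / z + exp (- 3 / 4 * real n))"
    (is "measure_pmf.prob _ ?G \<ge> _")
proof -
  let ?M = "forward_arcs_pmf n p"
  let ?Z = "\<lambda>F. total_deviation n p F + config_count n F"
  let ?t = "2 * real n * sqrt (real n * p)"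
  let ?B = "{F. \<exists>S\<subseteq>{..<n}. p * real n ^ 2 / 4 + ?t \<le> real (card (F \<inter> S \<times> ({..<n} - S)))}"
  have Z0: "0 \<le> ?Z F" for F
    unfolding total_deviation_def config_count_def
    by (intro add_nonneg_nonneg sum_nonneg deviation_nonneg) auto
  have "measure_pmf.expectation ?M ?Z \<le> 4 * (real n * sqrt (real n * p)) + 5 * (real n * p) ^ 6"
    using expectation_total_deviation_le[OF p d] expectation_config_count_le[OF p d] by simp
  then have "measure_pmf.expectation ?M ?Z / z \<le> (4 * (real n * sqrt (real n * p)) + 5 * (real n * p) ^ 6) / z"
    using z by (intro divide_right_mono) auto
  moreover have "measure_pmf.prob ?M {F. z \<le> ?Z F} \<le> measure_pmf.expectation ?M ?Z / z"
    using integral_Markov_inequality_measure[of ?M ?Z "{}" z] Z0 z by simp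
  moreover have "measure_pmf.prob ?M ({F. z \<le> ?Z F} \<union> ?B) \<le>
      measure_pmf.prob ?M {F. z \<le> ?Z F} + measure_pmf.prob ?M ?B"
    by (rule measure_Un_le) auto
  ultimately have bad: "measure_pmf.prob ?M ({F. z \<le> ?Z F} \<union> ?B) \<le>
      (4 * (real n * sqrt (real n * p)) + 5 * (real n * p) ^ 6) / z + exp (- 3 / 4 * real n)"
    using prob_exists_dicut_large[OF p d] by linarith
  \<comment> \<open>Intersecting with the support provides
    \<open>F \<subseteq> arc_pairs n\<close>.\<close>
  have "- ({F. z \<le> ?Z F} \<union> ?B) \<inter> set_pmf ?M \<subseteq> closure_digraph n -` ?G"
  proof
    fix F assume "F \<in> - ({F. z \<le> ?Z F} \<union> ?B) \<inter> set_pmf ?M"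
    then have Z: "?Z F \<le> z" and F: "F \<subseteq> arc_pairs n"
      and cut: "\<And>S. S \<subseteq> {..<n} \<Longrightarrow> real (card (F \<inter> S \<times> ({..<n} - S))) \<le> p * real n ^ 2 / 4 + ?t"
      using forward_arcs_pmf_subset by (auto simp: not_le intro: less_imp_le)
    have t: "0 \<le> ?t"
      using p by simp
    show "F \<in> closure_digraph n -` ?G"
      unfolding b_def vimage_eq mem_Collect_eq
    proof
      show "\<bar>real (nu_t (closure_digraph n F)) - p * real n ^ 2 / 2\<bar> \<le> z + real n * p + p + ?t"
        using abs_nu_t_le[OF F p] Z t p(1) by linarith
      show "\<bar>real (tau_t (closure_digraph n F)) - 3 * p * real n ^ 2 / 4\<bar> \<le> z + real n * p + p + ?t"
        using abs_tau_t_le[OF F p cut t] Z by linarith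
    qed
  qed
  then have "measure_pmf.prob ?M (- ({F. z \<le> ?Z F} \<union> ?B) \<inter> set_pmf ?M) \<le>
      measure_pmf.prob ?M (closure_digraph n -` ?G)"
    by (intro measure_pmf.finite_measure_mono) auto
  then have "measure_pmf.prob ?M (- ({F. z \<le> ?Z F} \<union> ?B)) \<le>
      measure_pmf.prob (random_digraph n p) ?G"
    unfolding random_digraph_eq by (simp add: measure_Int_set_pmf)
  moreover have "measure_pmf.prob ?M (- ({F. z \<le> ?Z F} \<union> ?B)) =
      1 - measure_pmf.prob ?M ({F. z \<le> ?Z F} \<union> ?B)"
    using measure_pmf.prob_compl[of "{F. z \<le> ?Z F} \<union> ?B" ?M] by (simp add: Compl_eq_Diff_UNIV)
  ultimately show ?thesis
    using bad by linarith
qed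

theorem theorem10:
  defines "p \<equiv> \<lambda>n :: nat. real n powr (-1 + 1/12)"
  shows "\<exists>f g :: nat \<Rightarrow> real.
    f \<in> o(\<lambda>n. real n powr (13/12)) \<and> g \<in> o(\<lambda>n. real n powr (13/12)) \<and>
    (\<lambda>n. measure_pmf.prob (random_digraph n (p n))
           {D. \<bar>real (nu_t D) - p n * real n ^ 2 / 2\<bar> \<le> f n \<and>
               \<bar>real (tau_t D) - 3 * p n * real n ^ 2 / 4\<bar> \<le> g n}) \<longlonglongrightarrow> 1"
proof -
  \<comment> \<open>The expected error is at most of order \<open>n powr (50/48)\<close>, from
    \<open>n sqrt (n p)\<close>, and the target is \<open>n powr (52/48)\<close>; the threshold lies
    strictly between.\<close>
  define z where "z = (\<lambda>n :: nat. real n powr (51/48))"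
  define b where "b = (\<lambda>n. z n + real n * p n + p n + 2 * real n * sqrt (real n * p n))"
  define err where "err = (\<lambda>n. (4 * (real n * sqrt (real n * p n)) + 5 * (real n * p n) ^ 6) / z n +
    exp (- 3 / 4 * real n))"
  let ?P = "\<lambda>n. measure_pmf.prob (random_digraph n (p n))
    {D. \<bar>real (nu_t D) - p n * real n ^ 2 / 2\<bar> \<le> b n \<and> \<bar>real (tau_t D) - 3 * p n * real n ^ 2 / 4\<bar> \<le> b n}"
  have "b \<in> o(\<lambda>n. real n powr (13/12))"
    unfolding b_def z_def p_def by real_asymp
  moreover have "?P \<longlonglongrightarrow> 1"
  proof (rule tendsto_sandwich)
    show "(\<lambda>n. 1 - err n) \<longlonglongrightarrow> 1"
      unfolding err_def z_def p_def by real_asymp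
    \<comment> \<open>At \<open>n = 0\<close> the product of \<open>n\<close> and \<open>p n\<close>
      is 0 instead of at least 1.\<close>
    show "\<forall>\<^sub>F n in sequentially. 1 - err n \<le> ?P n"
      using eventually_gt_at_top[of 0]
    proof eventually_elim
      case (elim n)
      have n: "1 \<le> real n"
        using elim by simp
      have "real n * p n = real n powr 1 * real n powr (-1 + 1/12)"
        using n unfolding p_def by simp
      also have "\<dots> = real n powr (1/12)"
        unfolding powr_add[symmetric] by simp
      finally have "1 \<le> real n * p n"
        using n by (simp add: ge_one_powr_ge_zero)
      moreover have "p n \<le> 1"
        using n powr_mono[of "-1 + 1/12" 0 "real n"] unfolding p_def by simp
      ultimately show ?case
        using prob_random_digraph_ge[of "p n" n "z n"] n
        unfolding err_def b_def by (simp add: p_def z_def)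
    qed
  qed (auto simp: measure_pmf.prob_le_1)
  ultimately show ?thesis
    by blast
qed

end
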